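(* Let $n>3$ be odd. The class $\langle L_n\cup I\rangle$ does not contain any Bol loop; that is, for every positive integer $m<n$ with $\gcd(m,n)=\gcd(m-1,n)=1$, $\langle L_n(m)\cup I\rangle$ is not a Bol neutrosophic loop.
   Context: For $n>3$ odd and $m<n$ a positive integer with $\gcd(m,n)=\gcd(m-1,n)=1$, the loop $L_n(m)$ is the set $\{e,1,2,\dots,n\}$ with operation: $e\cdot i=i\cdot e=i$ for all $i$; $i\cdot i=e$ for all $i$; and for $i,j\in\{1,\dots,n\}$, $i\neq j$, $i\cdot j$ is the element $s\in\{1,\dots,n\}$ with $s\equiv mj-(m-1)i \pmod n$. The neutrosophic loop $\langle L_n(m)\cup I\rangle$ is the set $\{e,1,\dots,n,eI,1I,\dots,nI\}$ of $2(n+1)$ distinct symbols, with the product of $L_n(m)$ on $\{e,1,\dots,n\}$ and $x\cdot(yI)=(xI)\cdot y=(xI)\cdot(yI)=(x\cdot y)I$ for $x,y\in L_n(m)$. $\langle L_n\cup I\rangle$ denotes the collection of all such $\langle L_n(m)\cup I\rangle$ for fixed $n$. A neutrosophic loop is a Bol neutrosophic loop if $((xy)z)y=x((yz)y)$ for all its elements $x,y,z$. *)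

theory Defs
  imports "HOL-Algebra.Group" "HOL-Number_Theory.Cong"
begin

text \<open>
  The record type \<^typ>\<open>'a monoid\<close> is used only as a carrier together with a product and a
  distinguished element; no monoid laws are assumed.
\<close>

datatype loop_elt = E | Num nat

text \<open>
  The coefficients are taken in \<^typ>\<open>int\<close>, so that the difference is not truncated.
\<close>

definition Ln_index :: "nat \<Rightarrow> nat \<Rightarrow> nat \<Rightarrow> nat \<Rightarrow> nat" where
  "Ln_index n m i j =
     (THE s. s \<in> {1..n} \<and> [int s = int m * int j - (int m - 1) * int i] (mod int n))"

fun Ln_mult :: "nat \<Rightarrow> nat \<Rightarrow> loop_elt \<Rightarrow> loop_elt \<Rightarrow> loop_elt" where
  "Ln_mult n m E y = y"
| "Ln_mult n m (Num i) E = Num i"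
| "Ln_mult n m (Num i) (Num j) = (if i = j then E else Num (Ln_index n m i j))"

definition Ln_loop :: "nat \<Rightarrow> nat \<Rightarrow> loop_elt monoid" where
  "Ln_loop n m = \<lparr>carrier = insert E (Num ` {1..n}), monoid.mult = Ln_mult n m, monoid.one = E\<rparr>"

text \<open>
  \<open>Pure x\<close> is the element \<open>x\<close> itself and \<open>Ind x\<close> is the symbol \<open>xI\<close>.
\<close>

datatype 'a neutro = Pure 'a | Ind 'a

fun neutro_mult :: "('a \<Rightarrow> 'a \<Rightarrow> 'a) \<Rightarrow> 'a neutro \<Rightarrow> 'a neutro \<Rightarrow> 'a neutro" where
  "neutro_mult f (Pure x) (Pure y) = Pure (f x y)"
| "neutro_mult f (Pure x) (Ind y) = Ind (f x y)"
| "neutro_mult f (Ind x) (Pure y) = Ind (f x y)"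
| "neutro_mult f (Ind x) (Ind y) = Ind (f x y)"

definition neutrosophic :: "'a monoid \<Rightarrow> 'a neutro monoid" where
  "neutrosophic L =
     \<lparr>carrier = Pure ` carrier L \<union> Ind ` carrier L,
      monoid.mult = neutro_mult (monoid.mult L),
      monoid.one = Pure (monoid.one L)\<rparr>"

definition neutrosophic_Ln_class :: "nat \<Rightarrow> loop_elt neutro monoid set" where
  "neutrosophic_Ln_class n =
     {neutrosophic (Ln_loop n m) | m. 0 < m \<and> m < n \<and> gcd m n = 1 \<and> gcd (m - 1) n = 1}"

text \<open>
  Only the Bol identity is required, not that every equation in the structure is uniquely solvable:
  \<open>eI \<cdot> y = e\<close> has no solution \<open>y\<close> in a structure \<^term>\<open>neutrosophic L\<close>, so with that requirement
  no such structure would be Bol, for trivial reasons.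
\<close>

definition bol :: "'a monoid \<Rightarrow> bool" where
  "bol L \<longleftrightarrow>
     (\<forall>x \<in> carrier L. \<forall>y \<in> carrier L. \<forall>z \<in> carrier L.
        ((x \<otimes>\<^bsub>L\<^esub> y) \<otimes>\<^bsub>L\<^esub> z) \<otimes>\<^bsub>L\<^esub> y = x \<otimes>\<^bsub>L\<^esub> ((y \<otimes>\<^bsub>L\<^esub> z) \<otimes>\<^bsub>L\<^esub> y))"

lemma Ln_index_unique:
  assumes "n > 0"
  shows "\<exists>!s. s \<in> {1..n} \<and> [int s = int m * int j - (int m - 1) * int i] (mod int n)"
proof -
  define t where "t = int m * int j - (int m - 1) * int i"
  define r where "r = nat ((t - 1) mod int n) + 1"
  have "0 \<le> (t - 1) mod int n" "(t - 1) mod int n < int n"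
    using assms by auto
  then have r: "r \<in> {1..n}" "int r = (t - 1) mod int n + 1"
    unfolding r_def by auto
  then have rt: "[int r = t] (mod int n)"
    by (simp add: cong_def mod_simps)
  have "s = r" if "s \<in> {1..n}" "[int s = t] (mod int n)" for s
  proof -
    have "[int s = int r] (mod int n)"
      using that(2) rt cong_sym cong_trans by blast
    then have "[int s - 1 = int r - 1] (mod int n)"
      by (intro cong_diff cong_refl)
    then have "int s - 1 = int r - 1"
      using that(1) r(1) by (simp add: cong_def)
    then show ?thesis by simp
  qed
  then show ?thesis
    using r(1) rt unfolding t_def by blast
qed

end

theory Submission
  imports Defs
begin

text \<open>
  Every loop embeds in its neutrosophic extension, so it suffices to violate the Bol identity
  inside \<open>L\<^sub>n(m)\<close>. There, products of distinct numbers are affine combinations modulo \<open>n\<close>, and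
  \<open>m = 1\<close> is excluded because \<open>gcd 0 n = n\<close>.

  With \<open>z = e\<close> the Bol identity becomes \<open>(x y) y = x\<close>. For distinct numbers \<open>x\<close>, \<open>y\<close> the difference
  of the two sides is \<open>m (m - 2) (x - y)\<close> modulo \<open>n\<close>. Taking \<open>x - y = 1\<close> and cancelling \<open>m\<close>, which
  is a unit, forces \<open>m = 2\<close>.

  For \<open>m = 2\<close> the product \<open>i j = 2 j - i\<close> reflects \<open>i\<close> in the point \<open>j\<close>, and \<open>(x y) y = x\<close> does hold.
  But as long as no two equal numbers meet, the left side of the Bol identity is \<open>4 y - 2 z - x\<close> and
  the right side is \<open>6 y - 4 z - x\<close>. They differ by \<open>2 (z - y)\<close>, which is nonzero for \<open>z - y = 1\<close>
  and \<open>n\<close> odd. The triple \<open>x = 2\<close>, \<open>y = 1\<close>, \<open>z = 2\<close> avoids all coincidences once \<open>n > 3\<close>.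
\<close>

lemma bol_if_bol_neutrosophic:
  assumes "bol (neutrosophic L)"
  shows "bol L"
  unfolding bol_def
proof (intro ballI)
  fix x y z
  assume "x \<in> carrier L" "y \<in> carrier L" "z \<in> carrier L"
  then have "Pure x \<in> carrier (neutrosophic L)" "Pure y \<in> carrier (neutrosophic L)"
    "Pure z \<in> carrier (neutrosophic L)"
    by (auto simp: neutrosophic_def)
  from assms[unfolded bol_def, rule_format, OF this]
  show "((x \<otimes>\<^bsub>L\<^esub> y) \<otimes>\<^bsub>L\<^esub> z) \<otimes>\<^bsub>L\<^esub> y = x \<otimes>\<^bsub>L\<^esub> ((y \<otimes>\<^bsub>L\<^esub> z) \<otimes>\<^bsub>L\<^esub> y)"
    by (simp add: neutrosophic_def)
qed

lemma bol_Ln_loopD: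
  assumes "bol (Ln_loop n m)" and "x \<in> insert E (Num ` {1..n})"
    and "y \<in> insert E (Num ` {1..n})" and "z \<in> insert E (Num ` {1..n})"
  shows "Ln_mult n m (Ln_mult n m (Ln_mult n m x y) z) y
    = Ln_mult n m x (Ln_mult n m (Ln_mult n m y z) y)"
  using assms(1)[unfolded bol_def, rule_format, of x y z] assms(2-4)
  by (simp only: Ln_loop_def partial_object.simps monoid.simps)

lemma Ln_mult_E_right [simp]: "Ln_mult n m x E = x"
  by (cases x) auto

lemma Ln_index_eqI:
  assumes "s \<in> {1..n}" and "[int s = int m * int j - (int m - 1) * int i] (mod int n)"
  shows "Ln_index n m i j = s"
proof -
  have "n > 0"
    using assms(1) by simp
  from the1_equality[OF Ln_index_unique[OF this] conjI[OF assms]] show ?thesis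
    unfolding Ln_index_def .
qed

lemma Ln_index_cong:
  assumes "n > 0"
  shows "[int (Ln_index n m i j) = int m * int j - (int m - 1) * int i] (mod int n)"
  using theI'[OF Ln_index_unique[OF assms, of m j i]] unfolding Ln_index_def by blast

text \<open>
  The instance \<open>x = 2\<close>, \<open>y = 1\<close>, \<open>z = e\<close> of the Bol identity already gives \<open>n dvd m (m - 2)\<close>.
\<close>

lemma bol_Ln_loop_imp_eq_2:
  assumes "bol (Ln_loop n m)" and "1 < m" and "m < n" and "coprime m n"
  shows "m = 2"
proof (rule ccontr)
  assume "m \<noteq> 2"
  with assms have m: "3 \<le> m" by simp
  \<comment> \<open>the product \<open>2 1\<close> is \<open>2 - m\<close> modulo \<open>n\<close>, which has this representative since \<open>m \<ge> 3\<close>\<close>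
  define s where "s = n + 2 - m"
  have s: "s \<in> {1..n}" "s \<noteq> 1" and int_s: "int s = int n + 2 - int m"
    using m assms(3) unfolding s_def by auto
  have "Ln_index n m 2 1 = s"
    using s(1) by (intro Ln_index_eqI) (auto simp: int_s cong_iff_dvd_diff)
  moreover have "Ln_mult n m (Ln_mult n m (Num 2) (Num 1)) (Num 1) = Num 2"
    using bol_Ln_loopD[OF assms(1), of "Num 2" "Num 1" E] assms(2,3) by simp
  ultimately have "Ln_index n m s 1 = 2"
    using s(2) by simp
  then have "[2 = int m * 1 - (int m - 1) * int s] (mod int n)"
    using Ln_index_cong[of n m s 1] assms(3) by simp
  then have "int n dvd 2 - (int m * 1 - (int m - 1) * int s)"
    by (simp add: cong_iff_dvd_diff)
  also have "2 - (int m * 1 - (int m - 1) * int s)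
      = (int m - 1) * int n - int m * (int m - 2)"
    by (simp add: int_s algebra_simps)
  finally have "int n dvd int m * (int m - 2)"
    using dvd_diff[of "int n" "(int m - 1) * int n" "(int m - 1) * int n - int m * (int m - 2)"]
    by simp
  moreover have "coprime (int n) (int m)"
    using assms(4) by (simp add: coprime_commute)
  ultimately have "int n dvd int m - 2"
    by (simp add: coprime_dvd_mult_right_iff)
  then show False
    using zdvd_imp_le[of "int n" "int m - 2"] m assms(3) by simp
qed

text \<open>
  At \<open>x = 2\<close>, \<open>y = 1\<close>, \<open>z = 2\<close> the two sides of the Bol identity are \<open>- 2\<close> and \<open>- 4\<close> modulo \<open>n\<close>.
\<close>

lemma not_bol_Ln_loop_2:
  assumes "n > 3" and "odd n"
  shows "\<not> bol (Ln_loop n 2)"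
proof
  assume "bol (Ln_loop n 2)"
  from bol_Ln_loopD[OF this, of "Num 2" "Num 1" "Num 2"] assms(1)
  have bol: "Ln_mult n 2 (Ln_mult n 2 (Ln_mult n 2 (Num 2) (Num 1)) (Num 2)) (Num 1)
      = Ln_mult n 2 (Num 2) (Ln_mult n 2 (Ln_mult n 2 (Num 1) (Num 2)) (Num 1))"
    by simp
  have n: "n > 4"
    using assms by (cases "n = 4") auto
  have "Ln_index n 2 2 1 = n" "Ln_index n 2 n 2 = 4" "Ln_index n 2 4 1 = n - 2"
    using n by (auto intro!: Ln_index_eqI simp: cong_iff_dvd_diff)
  then have left: "Ln_mult n 2 (Ln_mult n 2 (Ln_mult n 2 (Num 2) (Num 1)) (Num 2)) (Num 1)
      = Num (n - 2)"
    using n by simp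
  have "Ln_index n 2 1 2 = 3" "Ln_index n 2 3 1 = n - 1" "Ln_index n 2 2 (n - 1) = n - 4"
    using n by (auto intro!: Ln_index_eqI simp: cong_iff_dvd_diff)
  then have right: "Ln_mult n 2 (Num 2) (Ln_mult n 2 (Ln_mult n 2 (Num 1) (Num 2)) (Num 1))
      = Num (n - 4)"
    using n by simp
  show False
    using bol left right n by simp
qed

theorem theorem4p1p11:
  fixes n :: nat
  assumes "n > 3" and "odd n"
  shows "\<forall>N \<in> neutrosophic_Ln_class n. \<not> bol N"
proof
  fix N
  assume "N \<in> neutrosophic_Ln_class n"
  then obtain m where N: "N = neutrosophic (Ln_loop n m)"
    and m: "0 < m" "m < n" "gcd m n = 1" "gcd (m - 1) n = 1"
    unfolding neutrosophic_Ln_class_def by (elim CollectE exE conjE)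
  have "m \<noteq> 1"
    using m(4) assms(1) by auto
  then have "1 < m"
    using m(1) by simp
  show "\<not> bol N"
  proof
    assume "bol N"
    then have bol: "bol (Ln_loop n m)"
      using N bol_if_bol_neutrosophic by blast
    with \<open>1 < m\<close> m(2,3) have "m = 2"
      by (intro bol_Ln_loop_imp_eq_2) (auto simp: coprime_iff_gcd_eq_1)
    with bol not_bol_Ln_loop_2[OF assms] show False
      by simp
  qed
qed

end
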